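(* Let $n\ge1$ be an integer, let $\mathcal X\subset\mathbb R^2$ be an $n$-poised set of nodes, and let $\ell$ be a line which passes through exactly $4$ nodes of $\mathcal X$. Suppose $\ell$ is used by at least four nodes from $\mathcal X$. Then $\ell$ is used by exactly six nodes from $\mathcal X$. Moreover, if $\ell$ is used by six nodes, then these six nodes form a $2$-poised set. Furthermore, in the latter case, if $\mathcal X$ is a $GC_n$-set then the six nodes form a $GC_2$-set.
   Context: $\Pi_n$ denotes the space of all bivariate real polynomials of total degree $\le n$, of dimension $N=\tfrac12(n+1)(n+2)$. A finite set $\mathcal X$ of distinct nodes in the plane is $n$-poised if for any data $(c_A)_{A\in\mathcal X}$ there is a unique $p\in\Pi_n$ with $p(A)=c_A$ for all $A\in\mathcal X$ (so $|\mathcal X|=N$). For an $n$-poised set $\mathcal X$ and $A\in\mathcal X$, the fundamental polynomial $p_A^\star\in\Pi_n$ is the unique polynomial in $\Pi_n$ with $p_A^\star(A)=1$ and $p_A^\star|_{\mathcal X\setminus\{A\}}=0$. A line is identified with a polynomial of degree $1$ defining it. A node $A\in\mathcal X$ uses a line $\ell$ if $\ell$ divides $p_A^\star$, i.e. $p_A^\star=\ell q$ for some $q\in\Pi_{n-1}$. A $GC_n$-set is an $n$-poised set of nodes in which the fundamental polynomial of each node is a product of $n$ linear factors. *)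

theory Defs
  imports Complex_Main "HOL-Computational_Algebra.Computational_Algebra"
begin

text \<open>
  Bivariate real polynomials are elements of \<open>\<real>[x][y]\<close>: \<open>coeff (coeff p i) j\<close> is the
  coefficient of \<open>x^j y^i\<close>, so \<open>y\<close> is the outer and \<open>x\<close> the inner variable.
\<close>

type_synonym bipoly = "real poly poly"
type_synonym point = "real \<times> real"

definition eval2 :: "bipoly \<Rightarrow> point \<Rightarrow> real" where
  "eval2 p A = poly (poly p [:snd A:]) (fst A)"

lemma eval2_simps [simp]:
  "eval2 0 A = 0" "eval2 1 A = 1"
  "eval2 (p + q) A = eval2 p A + eval2 q A"
  "eval2 (p * q) A = eval2 p A * eval2 q A"
  by (simp_all add: eval2_def)

lemma eval2_monom: "eval2 (monom (monom c j) i) (x, y) = c * x ^ j * y ^ i"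
  by (simp add: eval2_def poly_monom)

definition Pi_n :: "nat \<Rightarrow> bipoly set" where
  "Pi_n n = {p. \<forall>i j. coeff (coeff p i) j \<noteq> 0 \<longrightarrow> i + j \<le> n}"

definition poised :: "nat \<Rightarrow> point set \<Rightarrow> bool" where
  "poised n X \<longleftrightarrow> finite X \<and>
     (\<forall>c :: point \<Rightarrow> real. \<exists>!p. p \<in> Pi_n n \<and> (\<forall>A\<in>X. eval2 p A = c A))"

text \<open>The following is meaningful only if \<open>X\<close> is \<open>n\<close>-poised and \<open>A \<in> X\<close>.\<close>

definition fundamental_poly :: "nat \<Rightarrow> point set \<Rightarrow> point \<Rightarrow> bipoly" where
  "fundamental_poly n X A =
     (THE p. p \<in> Pi_n n \<and> eval2 p A = 1 \<and> (\<forall>B\<in>X - {A}. eval2 p B = 0))"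

lemma fundamental_poly_ex1:
  assumes "poised n X" "A \<in> X"
  shows "\<exists>!p. p \<in> Pi_n n \<and> eval2 p A = 1 \<and> (\<forall>B\<in>X - {A}. eval2 p B = 0)"
proof -
  have eq: "(p \<in> Pi_n n \<and> (\<forall>B\<in>X. eval2 p B = (if B = A then 1 else 0))) =
            (p \<in> Pi_n n \<and> eval2 p A = 1 \<and> (\<forall>B\<in>X - {A}. eval2 p B = 0))" for p
    using assms(2) by auto
  have "\<exists>!p. p \<in> Pi_n n \<and> (\<forall>B\<in>X. eval2 p B = (if B = A then 1 else 0))"
    using assms(1)[unfolded poised_def, THEN conjunct2, THEN spec, of "\<lambda>B. if B = A then 1 else 0"] .
  then show ?thesis unfolding eq .
qed

text \<open>A line is identified with a defining polynomial of total degree exactly 1.\<close>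

definition is_line :: "bipoly \<Rightarrow> bool" where
  "is_line l \<longleftrightarrow> l \<in> Pi_n 1 \<and> l \<notin> Pi_n 0"

definition uses_line :: "nat \<Rightarrow> point set \<Rightarrow> point \<Rightarrow> bipoly \<Rightarrow> bool" where
  "uses_line n X A l \<longleftrightarrow> (\<exists>q\<in>Pi_n (n - 1). fundamental_poly n X A = l * q)"

definition GC_set :: "nat \<Rightarrow> point set \<Rightarrow> bool" where
  "GC_set n X \<longleftrightarrow> poised n X \<and>
     (\<forall>A\<in>X. \<exists>L :: nat \<Rightarrow> bipoly. (\<forall>i<n. is_line (L i)) \<and>
        fundamental_poly n X A = (\<Prod>i<n. L i))"

end

theory Submission
  imports Defs
begin

text \<open>
  Let \<open>T\<close> be the four nodes on the line \<open>l\<close>, \<open>V\<close> four nodes using \<open>l\<close>, with fundamental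
  polynomials \<open>l * q A\<close>, and \<open>Z\<close> the remaining nodes. A combination of the \<open>q A\<close> vanishing on
  three points of \<open>T\<close> is divisible by \<open>l\<close>, which yields \<open>h \<noteq> 0\<close> of degree at most \<open>n - 2\<close> vanishing
  on \<open>Z\<close>. Some \<open>f = q A\<close> is not a multiple of \<open>h\<close> by a polynomial of degree at most 1. Since
  \<open>Q * h + M * f\<close> with \<open>Q\<close> quadratic and \<open>M\<close> linear has \<open>6 + 3\<close> free coefficients and has to
  vanish only at the 8 points of \<open>T \<union> V\<close>, there is a nontrivial syzygy \<open>Q * h + M * f = 0\<close>.
  It makes \<open>M\<close> a line and \<open>C = h / M = - f / Q\<close> a curve of degree \<open>n - 3\<close> that misses at most two
  points of \<open>Z\<close>, because these are common zeros of \<open>M\<close> and \<open>Q\<close>. Hence at most 6 nodes lie off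
  the curve \<open>l * C\<close>. So few nodes off a curve of degree \<open>n - k\<close> force the curve to be maximal: the
  nodes off it are \<open>k\<close>-poised, and their fundamental polynomials are, up to constants, those of
  degree \<open>k\<close> multiplied by the curve. For \<open>l * C\<close> this gives six nodes using \<open>l\<close>, and
  maximality of \<open>C\<close> itself (\<open>k = 3\<close>) rules out any further ones.
\<close>

section \<open>Total degree\<close>

text \<open>Substituting \<open>x y\<close> for \<open>x\<close> turns the total degree into the degree in the outer
  variable \<open>y\<close>, so that additivity of the total degree comes from additivity of \<open>degree\<close>.\<close>

definition x_to_xy :: "real poly \<Rightarrow> bipoly" where
  "x_to_xy a = pcompose (map_poly (\<lambda>c. [:c:]) a) (monom [:0, 1:] (Suc 0))"

definition tsubst :: "bipoly \<Rightarrow> bipoly" where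
  "tsubst p = poly (map_poly x_to_xy p) [:0, 1:]"

definition tdeg :: "bipoly \<Rightarrow> nat" where
  "tdeg p = degree (tsubst p)"

lemma map_poly_mult_hom:
  fixes f :: "'a::comm_semiring_1 \<Rightarrow> 'b::comm_semiring_1"
  assumes "f 0 = 0" "\<And>a b. f (a + b) = f a + f b" "\<And>a b. f (a * b) = f a * f b"
  shows "map_poly f (p * q) = map_poly f p * map_poly f q"
proof (rule poly_eqI)
  have hom_sum: "f (sum g A) = (\<Sum>i\<in>A. f (g i))" if "finite A" for g :: "nat \<Rightarrow> 'a" and A
    using that by (induction rule: finite_induct) (simp_all add: assms)
  show "coeff (map_poly f (p * q)) n = coeff (map_poly f p * map_poly f q) n" for n
    by (simp add: coeff_map_poly coeff_mult assms hom_sum)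
qed

lemma map_poly_add_hom:
  assumes "f 0 = 0" "\<And>a b. f (a + b) = f a + f b"
  shows "map_poly f (p + q) = map_poly f p + map_poly f q"
  by (rule poly_eqI) (simp add: coeff_map_poly assms)

lemma x_to_xy_simps [simp]:
  "x_to_xy 0 = 0"
  "x_to_xy (a + b) = x_to_xy a + x_to_xy b"
  "x_to_xy (a * b) = x_to_xy a * x_to_xy b"
  by (simp_all add: x_to_xy_def map_poly_add_hom map_poly_mult_hom pcompose_add pcompose_mult)

lemma coeff_x_to_xy: "coeff (x_to_xy a) k = monom (coeff a k) k"
proof -
  have "[:0, 1:] ^ k * [:c:] = monom c k" for c :: real
    by (metis monom_0 mult.right_neutral add.right_neutral monom_altdef mult_monom 
        mult_smult_left mult.commute smult_monom smult_1_left)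
  then show ?thesis
    by (simp add: x_to_xy_def coeff_map_poly)
qed

lemma tsubst_mult: "tsubst (p * q) = tsubst p * tsubst q"
  by (simp add: tsubst_def map_poly_mult_hom)

text \<open>The substitution sends x^j y^i to x^j y^(i+j), so distinct terms never merge and the
  coefficient of y^d records exactly the terms of total degree d.\<close>

lemma coeff_tsubst:
  "coeff (coeff (tsubst p) d) j = (if j \<le> d then coeff (coeff p (d - j)) j else 0)"
proof (induction p arbitrary: d j)
  case 0
  then show ?case by (simp add: tsubst_def)
next
  case (pCons a p)
  have "tsubst (pCons a p) = x_to_xy a + [:0, 1:] * tsubst p"
    by (simp add: tsubst_def map_poly_pCons)
  then have "coeff (coeff (tsubst (pCons a p)) d) j =
      (if j = d then coeff a d else 0) + (case d of 0 \<Rightarrow> 0 | Suc e \<Rightarrow> coeff (coeff (tsubst p) e) j)"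
    by (simp add: coeff_x_to_xy coeff_pCons split: nat.splits)
  also have "\<dots> = (if j \<le> d then coeff (coeff (pCons a p) (d - j)) j else 0)"
    by (auto simp: pCons.IH coeff_pCons Suc_diff_le not_le le_Suc_eq split: nat.splits)
  finally show ?case .
qed

lemma tsubst_eq_0_iff [simp]: "tsubst p = 0 \<longleftrightarrow> p = 0"
proof
  assume *: "tsubst p = 0"
  show "p = 0"
  proof (intro poly_eqI)
    fix i j
    show "coeff (coeff p i) j = coeff (coeff 0 i) j"
      using coeff_tsubst[of p "i + j" j] * by simp
  qed
qed (simp add: tsubst_def)

lemma Pi_n_iff: "p \<in> Pi_n n \<longleftrightarrow> tdeg p \<le> n"
proof
  assume *: "p \<in> Pi_n n"
  have "coeff (tsubst p) d = 0" if "d > n" for d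
    using * that unfolding Pi_n_def
    by (intro poly_eqI) (force simp: coeff_tsubst)
  then show "tdeg p \<le> n"
    unfolding tdeg_def by (intro degree_le) auto
next
  assume *: "tdeg p \<le> n"
  have "i + j \<le> n" if "coeff (coeff p i) j \<noteq> 0" for i j
  proof -
    have "coeff (coeff (tsubst p) (i + j)) j \<noteq> 0"
      using that by (simp add: coeff_tsubst)
    then have "i + j \<le> tdeg p"
      unfolding tdeg_def by (metis coeff_0 le_degree)
    with * show ?thesis by simp
  qed
  then show "p \<in> Pi_n n"
    by (auto simp: Pi_n_def)
qed

lemma tdeg_mult: "p \<noteq> 0 \<Longrightarrow> q \<noteq> 0 \<Longrightarrow> tdeg (p * q) = tdeg p + tdeg q"
  by (simp add: tdeg_def tsubst_mult degree_mult_eq)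

lemma Pi_n_0 [simp]: "0 \<in> Pi_n n"
  by (simp add: Pi_n_def)

lemma Pi_n_add: "p \<in> Pi_n n \<Longrightarrow> q \<in> Pi_n n \<Longrightarrow> p + q \<in> Pi_n n"
  by (auto simp: Pi_n_def) (metis add.left_neutral)

lemma Pi_n_sum: "(\<And>i. i \<in> I \<Longrightarrow> f i \<in> Pi_n n) \<Longrightarrow> sum f I \<in> Pi_n n"
  by (induction I rule: infinite_finite_induct) (auto intro: Pi_n_add)

lemma Pi_n_mult: "p \<in> Pi_n m \<Longrightarrow> q \<in> Pi_n n \<Longrightarrow> m + n \<le> k \<Longrightarrow> p * q \<in> Pi_n k"
  by (cases "p = 0 \<or> q = 0") (auto simp: Pi_n_iff tdeg_mult)

lemma Pi_n_const [simp]: "[:[:c:]:] \<in> Pi_n n"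
  by (auto simp: Pi_n_def coeff_pCons split: nat.splits)

lemma Pi_n_diff: "p \<in> Pi_n n \<Longrightarrow> q \<in> Pi_n n \<Longrightarrow> p - q \<in> Pi_n n"
  by (auto simp: Pi_n_def) (metis diff_self)

lemma Pi_0_const:
  assumes "p \<in> Pi_n 0"
  obtains c where "p = [:[:c:]:]"
proof
  show "p = [:[:coeff (coeff p 0) 0:]:]"
    using assms unfolding Pi_n_def
    by (intro poly_eqI) (auto simp: coeff_pCons split: nat.splits)
qed

lemma is_line_iff_tdeg: "is_line m \<longleftrightarrow> tdeg m = 1"
  by (auto simp: is_line_def Pi_n_iff)

lemma eval2_const [simp]: "eval2 [:[:c:]:] A = c"
  by (simp add: eval2_def)

lemma eval2_diff [simp]: "eval2 (p - q) A = eval2 p A - eval2 q A"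
  by (simp add: eval2_def)

lemma eval2_sum: "eval2 (sum f I) A = (\<Sum>i\<in>I. eval2 (f i) A)"
  by (induction I rule: infinite_finite_induct) auto

section \<open>Linear algebra\<close>

text \<open>Gaussian elimination by induction on the equations: an equation \<open>e\<close> with a
  nonzero coefficient is solved for an unknown \<open>k\<close>, which is then removed from the
  other equations.\<close>

lemma homogeneous_system_nontrivial:
  fixes a :: "'i \<Rightarrow> 'e \<Rightarrow> real"
  assumes "finite E" "finite I" "card E < card I"
  shows "\<exists>c. (\<exists>i\<in>I. c i \<noteq> 0) \<and> (\<forall>e\<in>E. (\<Sum>i\<in>I. c i * a i e) = 0)"
  using assms
proof (induction E arbitrary: I a rule: finite_induct)
  case empty
  then have "I \<noteq> {}" by auto
  then show ?case by (intro exI[of _ "\<lambda>_. 1"]) auto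
next
  case (insert e E)
  show ?case
  proof (cases "\<forall>i\<in>I. a i e = 0")
    case True
    from insert have "card E < card I" by simp
    from insert.IH[OF insert.prems(1) this, of a] obtain c
      where c: "\<exists>i\<in>I. c i \<noteq> 0" "\<forall>e\<in>E. (\<Sum>i\<in>I. c i * a i e) = 0" by blast
    with True show ?thesis by (intro exI[of _ c]) auto
  next
    case False
    then obtain k where k: "k \<in> I" "a k e \<noteq> 0" by blast
    define J where "J = I - {k}"
    have J: "finite J" "k \<notin> J" "I = insert k J"
      using k insert.prems by (auto simp: J_def)
    have "card E < card J"
      using insert J by simp
    from insert.IH[OF J(1) this, of "\<lambda>i e'. a i e' - a i e / a k e * a k e'"] obtain c
      where c: "\<exists>i\<in>J. c i \<noteq> 0"
        "\<forall>e'\<in>E. (\<Sum>i\<in>J. c i * (a i e' - a i e / a k e * a k e')) = 0" by blast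
    define s where "s = (\<Sum>i\<in>J. c i * a i e)"
    define c' where "c' = c(k := - s / a k e)"
    have split: "(\<Sum>i\<in>I. c' i * a i e') = - s / a k e * a k e' + (\<Sum>i\<in>J. c i * a i e')" for e'
    proof -
      have "(\<Sum>i\<in>J. c' i * a i e') = (\<Sum>i\<in>J. c i * a i e')"
        using J by (intro sum.cong) (auto simp: c'_def)
      then show ?thesis using J by (simp add: c'_def)
    qed
    have "(\<Sum>i\<in>I. c' i * a i e') = 0" if "e' \<in> insert e E" for e'
    proof (cases "e' = e")
      case True
      then show ?thesis using k by (simp add: split s_def)
    next
      case False
      then have "0 = (\<Sum>i\<in>J. c i * (a i e' - a i e / a k e * a k e'))"
        using c that by auto
      also have "\<dots> = (\<Sum>i\<in>J. c i * a i e' - (a k e' / a k e) * (c i * a i e))"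
        by (intro sum.cong) (auto simp: algebra_simps)
      also have "\<dots> = (\<Sum>i\<in>J. c i * a i e') - a k e' / a k e * s"
        by (simp add: sum_subtractf s_def sum_distrib_left)
      finally show ?thesis by (simp add: split mult.commute)
    qed
    moreover have "\<exists>i\<in>I. c' i \<noteq> 0"
      using c J by (auto simp: c'_def)
    ultimately show ?thesis by blast
  qed
qed

section \<open>Counting coefficients against vanishing conditions\<close>

definition exps :: "nat \<Rightarrow> (nat \<times> nat) set" where
  "exps k = (SIGMA i:{..k}. {..k - i})"

text \<open>The index (i, j) stands for x^j y^i, outer exponent first as in \<open>coeff\<close>, so
  that \<open>card (exps k)\<close> is the dimension of \<open>Pi_n k\<close>.\<close>

definition poly_of :: "nat \<Rightarrow> (nat \<times> nat \<Rightarrow> real) \<Rightarrow> bipoly" where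
  "poly_of k c = (\<Sum>(i, j)\<in>exps k. monom (monom (c (i, j)) j) i)"

lemma finite_exps [simp]: "finite (exps k)"
  by (simp add: exps_def)

lemma card_exps: "card (exps k) = (\<Sum>i\<le>k. Suc (k - i))"
  by (simp add: exps_def)

lemma card_exps_numeral [simp]: "card (exps 1) = 3" "card (exps 2) = 6" "card (exps 3) = 10"
  by (simp_all add: card_exps numeral_eq_Suc)

lemma in_exps_iff: "(i, j) \<in> exps k \<longleftrightarrow> i + j \<le> k"
  by (auto simp: exps_def)

lemma coeff_poly_of:
  "coeff (coeff (poly_of k c) i) j = (if (i, j) \<in> exps k then c (i, j) else 0)"
proof -
  have "coeff (coeff (poly_of k c) i) j = 
      (\<Sum>e\<in>exps k. if e = (i, j) then c e else 0)"
    unfolding poly_of_def coeff_sum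
    by (intro sum.cong) (auto split: prod.splits)
  then show ?thesis by simp
qed

lemma poly_of_in_Pi_n: "poly_of k c \<in> Pi_n k"
  by (auto simp: Pi_n_def coeff_poly_of in_exps_iff split: if_splits)

lemma eval2_poly_of:
  "eval2 (poly_of k c) A = (\<Sum>(i, j)\<in>exps k. c (i, j) * fst A ^ j * snd A ^ i)"
  unfolding poly_of_def eval2_sum
  using eval2_monom[of _ _ _ "fst A" "snd A"] by (intro sum.cong) auto

lemma poly_of_nonzero: "e \<in> exps k \<Longrightarrow> c e \<noteq> 0 \<Longrightarrow> poly_of k c \<noteq> 0"
  using coeff_poly_of[of k c "fst e" "snd e"] by auto

text \<open>The coefficients of \<open>p\<close> and \<open>q\<close> together outnumber the
  conditions. Only the pair is claimed to be nonzero; the combination itself may be zero, which is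
  how a syzygy arises.\<close>

lemma exists_combination_vanishing:
  assumes "finite E" "card E < card (exps a) + card (exps b)"
  obtains p q where "p \<in> Pi_n a" "q \<in> Pi_n b" "p \<noteq> 0 \<or> q \<noteq> 0"
    "\<And>A. A \<in> E \<Longrightarrow> eval2 (p * f + q * g) A = 0"
proof -
  define mon where "mon e A = fst A ^ snd e * snd A ^ fst e" for e :: "nat \<times> nat" and A :: point
  have "finite (exps a <+> exps b)" "card E < card (exps a <+> exps b)"
    using assms by (simp_all add: card_Plus)
  from homogeneous_system_nontrivial[OF assms(1) this,
      of "case_sum (\<lambda>e A. mon e A * eval2 f A) (\<lambda>e A. mon e A * eval2 g A)"]
  obtain c where c: "\<exists>i\<in>exps a <+> exps b. c i \<noteq> 0"
    "\<forall>A\<in>E. (\<Sum>i\<in>exps a <+> exps b. c i *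
        case_sum (\<lambda>e A. mon e A * eval2 f A) (\<lambda>e A. mon e A * eval2 g A) i A) = 0" by blast
  have ev: "eval2 (poly_of k d) A = (\<Sum>e\<in>exps k. d e * mon e A)" for k d A
    by (simp add: eval2_poly_of mon_def case_prod_unfold mult.assoc)
  show thesis
  proof (rule that[of "poly_of a (c \<circ> Inl)" "poly_of b (c \<circ> Inr)"])
    show "poly_of a (c \<circ> Inl) \<noteq> 0 \<or> poly_of b (c \<circ> Inr) \<noteq> 0"
      using c(1) poly_of_nonzero[of _ a "c \<circ> Inl"] poly_of_nonzero[of _ b "c \<circ> Inr"]
      by (metis PlusE comp_apply)
    show "eval2 (poly_of a (c \<circ> Inl) * f + poly_of b (c \<circ> Inr) * g) A = 0" if "A \<in> E" for A
      using c(2) that by (auto simp: sum.Plus ev sum_distrib_right mult.assoc)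
  qed (simp_all add: poly_of_in_Pi_n)
qed

lemma exists_vanishing_poly:
  assumes "finite E" "card E < card (exps k)"
  obtains p where "p \<in> Pi_n k" "p \<noteq> 0" "\<And>A. A \<in> E \<Longrightarrow> eval2 p A = 0"
proof -
  from homogeneous_system_nontrivial[OF assms(1) finite_exps assms(2),
      of "\<lambda>e A. fst A ^ snd e * snd A ^ fst e"] obtain c
    where c: "\<exists>e\<in>exps k. c e \<noteq> 0"
      "\<forall>A\<in>E. (\<Sum>e\<in>exps k. c e * (fst A ^ snd e * snd A ^ fst e)) = 0" by blast
  then show thesis
    by (intro that[of "poly_of k c"] poly_of_in_Pi_n)
      (auto simp: eval2_poly_of case_prod_unfold mult.assoc dest: poly_of_nonzero)
qed

text \<open>Uniqueness gives existence: a scalar multiple of the data \<open>d\<close> enters as one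
  extra unknown, indexed by \<open>None\<close>, and makes the homogeneous system
  underdetermined.\<close>

lemma poisedI:
  assumes "finite E" "card E \<le> card (exps k)"
    and unisolvent: "\<And>p. p \<in> Pi_n k \<Longrightarrow> (\<And>A. A \<in> E \<Longrightarrow> eval2 p A = 0) \<Longrightarrow> p = 0"
  shows "poised k E"
  unfolding poised_def
proof (intro conjI allI)
  fix d :: "point \<Rightarrow> real"
  let ?I = "insert None (Some ` exps k)"
  have "card E < card ?I"
    using assms by (simp add: card_insert_if card_image)
  from homogeneous_system_nontrivial[OF assms(1) _ this,
      of "\<lambda>e A. case e of None \<Rightarrow> d A | Some e \<Rightarrow> fst A ^ snd e * snd A ^ fst e"]
  obtain c where c: "\<exists>i\<in>?I. c i \<noteq> 0"
    and "\<forall>A\<in>E. (\<Sum>i\<in>?I. c i *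
        (case i of None \<Rightarrow> d A | Some e \<Rightarrow> fst A ^ snd e * snd A ^ fst e)) = 0"
    by auto
  then have eq: "c None * d A + eval2 (poly_of k (c \<circ> Some)) A = 0" if "A \<in> E" for A
    using that by (auto simp: eval2_poly_of sum.reindex case_prod_unfold mult.assoc)
  \<comment> \<open>Otherwise the polynomial part alone would vanish on \<open>E\<close>, hence be
    zero, and the solution would be trivial.\<close>
  have nz: "c None \<noteq> 0"
  proof
    assume "c None = 0"
    then have "poly_of k (c \<circ> Some) = 0"
      using eq by (intro unisolvent poly_of_in_Pi_n) auto
    with c \<open>c None = 0\<close> poly_of_nonzero[of _ k "c \<circ> Some"] show False by auto
  qed
  define r where "r = [:[:- 1 / c None:]:] * poly_of k (c \<circ> Some)"
  have r: "r \<in> Pi_n k"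
    unfolding r_def using Pi_n_mult[OF Pi_n_const[of _ 0] poly_of_in_Pi_n] by simp
  have rd: "eval2 r A = d A" if "A \<in> E" for A
    unfolding r_def eval2_simps(4) eval2_const using eq[OF that] nz by (simp add: field_simps)
  have "p = r" if "p \<in> Pi_n k" "\<forall>A\<in>E. eval2 p A = d A" for p
    using unisolvent[of "p - r"] that r rd by (simp add: Pi_n_diff)
  with r rd show "\<exists>!p. p \<in> Pi_n k \<and> (\<forall>A\<in>E. eval2 p A = d A)"
    by blast
qed (rule assms)

lemma poised_eq_0:
  assumes "poised n X" "p \<in> Pi_n n" "\<And>A. A \<in> X \<Longrightarrow> eval2 p A = 0"
  shows "p = 0"
proof -
  have "\<exists>!p. p \<in> Pi_n n \<and> (\<forall>A\<in>X. eval2 p A = 0)"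
    using assms(1)[unfolded poised_def, THEN conjunct2, THEN spec, of "\<lambda>_. 0"] .
  then obtain r where "\<And>q. q \<in> Pi_n n \<Longrightarrow> (\<And>A. A \<in> X \<Longrightarrow> eval2 q A = 0) \<Longrightarrow> q = r"
    by blast
  from this[of p] this[of 0] show ?thesis using assms(2,3) by simp
qed

lemma poised_interpolates:
  assumes "poised n X"
  obtains p where "p \<in> Pi_n n" "\<And>A. A \<in> X \<Longrightarrow> eval2 p A = d A"
  using assms[unfolded poised_def, THEN conjunct2, THEN spec, of d] by blast

lemma card_poised_ge:
  assumes "poised n X"
  shows "card (exps n) \<le> card X"
proof (rule ccontr)
  assume "\<not> ?thesis"
  then obtain p where "p \<in> Pi_n n" "p \<noteq> 0" "\<And>A. A \<in> X \<Longrightarrow> eval2 p A = 0"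
    using exists_vanishing_poly[of X n] assms by (auto simp: poised_def)
  then show False using poised_eq_0[OF assms] by blast
qed

section \<open>Lines\<close>

lemma Pi_n_coeff: "p \<in> Pi_n n \<Longrightarrow> n < i + j \<Longrightarrow> coeff (coeff p i) j = 0"
  unfolding Pi_n_def by (metis (mono_tags, lifting) mem_Collect_eq not_less)

lemma is_lineE:
  assumes "is_line m"
  obtains a b c where "m = [:[:a, b:], [:c:]:]" "b \<noteq> 0 \<or> c \<noteq> 0"
proof
  have m: "coeff (coeff m i) j = 0" if "i + j > 1" for i j
    using assms that Pi_n_coeff[of m 1 i j] by (simp add: is_line_def)
  show "m = [:[:coeff (coeff m 0) 0, coeff (coeff m 0) 1:], [:coeff (coeff m 1) 0:]:]"
    by (intro poly_eqI) (auto simp: coeff_pCons m split: nat.splits)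
  show "coeff (coeff m 0) 1 \<noteq> 0 \<or> coeff (coeff m 1) 0 \<noteq> 0"
  proof (rule ccontr)
    assume *: "\<not> ?thesis"
    have "i + j \<le> 0" if "coeff (coeff m i) j \<noteq> 0" for i j
    proof -
      have "\<not> (i = 0 \<and> j = 1)" "\<not> (i = 1 \<and> j = 0)" using * that by metis+
      then have "i + j \<noteq> 1" by linarith
      moreover have "i + j \<le> 1" using m[of i j] that by force
      ultimately show ?thesis by simp
    qed
    then have "m \<in> Pi_n 0" by (auto simp: Pi_n_def)
    with assms show False by (simp add: is_line_def)
  qed
qed

lemma is_lineI:
  assumes "b \<noteq> 0 \<or> c \<noteq> 0"
  shows "is_line [:[:a, b:], [:c:]:]"
proof -
  let ?m = "[:[:a, b:], [:c:]:]"
  have "?m \<in> Pi_n 1"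
    by (auto simp: Pi_n_def coeff_pCons split: nat.splits)
  moreover have "?m \<notin> Pi_n 0"
    using assms Pi_n_coeff[of ?m 0 0 1] Pi_n_coeff[of ?m 0 1 0] by auto
  ultimately show ?thesis by (simp add: is_line_def)
qed

lemma eval2_line: "eval2 [:[:a, b:], [:c:]:] A = a + b * fst A + c * snd A"
  by (simp add: eval2_def algebra_simps)

lemma is_line_nonzero: "is_line m \<Longrightarrow> m \<noteq> 0"
  by (auto simp: is_line_def)

text \<open>Up to the unit \<open>c\<close> the line is the monic polynomial y - r(x) over the
  polynomials in x, so the factor theorem applies.\<close>

lemma line_dvd_iff_graph:
  fixes p :: bipoly
  assumes "c \<noteq> 0"
  shows "[:[:a, b:], [:c:]:] dvd p \<longleftrightarrow> poly p [:- a / c, - b / c:] = 0"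
proof -
  let ?r = "[:- a / c, - b / c:]"
  have "[:[:a, b:], [:c:]:] dvd [:- ?r, 1:]"
    by (rule dvdI[where k = "[:[:1 / c:]:]"]) (use assms in simp)
  moreover have "[:- ?r, 1:] dvd [:[:a, b:], [:c:]:]"
    by (rule dvdI[where k = "[:[:c:]:]"]) (use assms in simp)
  ultimately have "[:[:a, b:], [:c:]:] dvd p \<longleftrightarrow> [:- ?r, 1:] dvd p"
    by (blast intro: dvd_trans)
  then show ?thesis by (simp only: poly_eq_0_iff_dvd)
qed

text \<open>A vertical line is a prime of the coefficient ring and stays prime; for any other line,
  divisibility means vanishing under an evaluation into an integral domain.\<close>

lemma prime_elem_line:
  assumes "is_line m"
  shows "prime_elem m"
proof -
  from assms obtain a b c where m: "m = [:[:a, b:], [:c:]:]" "b \<noteq> 0 \<or> c \<noteq> 0"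
    by (rule is_lineE)
  show ?thesis
  proof (cases "c = 0")
    case True
    then have "m = [:[:a, b:]:]" "b \<noteq> 0" using m by auto
    then show ?thesis
      by (simp add: lift_prime_elem_poly prime_elem_linear_field_poly)
  next
    case False
    show ?thesis
    proof (rule prime_elemI)
      show "\<not> m dvd 1"
        using False by (simp add: m line_dvd_iff_graph)
      show "m dvd p \<or> m dvd q" if "m dvd p * q" for p q
        using that False by (simp add: m line_dvd_iff_graph)
    qed (use False m in auto)
  qed
qed

lemma poly_poly_inner: "poly (poly p r) x = poly (poly p [:poly r x:]) x"
  for r :: "'a::comm_ring_1 poly"
  by (induction p) auto

lemma degree_restrict_to_graph:
  assumes "q \<in> Pi_n k" "degree r \<le> 1"
  shows "degree (poly q r) \<le> k"
  unfolding poly_altdef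
proof (rule degree_sum_le)
  fix i
  show "degree (coeff q i * r ^ i) \<le> k"
  proof (cases "coeff q i = 0")
    case False
    then have "i + degree (coeff q i) \<le> k"
      using assms(1) by (auto simp: Pi_n_def)
    moreover have "degree (r ^ i) \<le> i"
      using degree_power_le[of r i] mult_le_mono1[OF assms(2), of i] by linarith
    ultimately show ?thesis
      using degree_mult_le[of "coeff q i" "r ^ i"] by linarith
  qed auto
qed auto

text \<open>The restriction to the line is a polynomial in one variable of degree at most
  \<open>k\<close> with more than \<open>k\<close> roots, hence zero. Nonvertical lines are
  parametrized by x, vertical ones by y.\<close>

lemma line_dvd_if_many_zeros:
  assumes "is_line m" "q \<in> Pi_n k" "finite E" "k < card E"
    and zeros: "\<And>A. A \<in> E \<Longrightarrow> eval2 m A = 0" "\<And>A. A \<in> E \<Longrightarrow> eval2 q A = 0"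
  shows "m dvd q"
proof -
  from assms(1) obtain a b c where m: "m = [:[:a, b:], [:c:]:]" and bc: "b \<noteq> 0 \<or> c \<noteq> 0"
    by (rule is_lineE)
  have on_line: "a + b * fst A + c * snd A = 0" if "A \<in> E" for A
    using zeros(1)[OF that] by (simp add: m eval2_line)
  show ?thesis
  proof (cases "c = 0")
    case False
    define r where "r = [:- a / c, - b / c:]"
    have snd_eq: "snd A = poly r (fst A)" if "A \<in> E" for A
      using on_line[OF that] False by (simp add: r_def field_simps)
    have inj: "inj_on fst E"
      by (rule inj_onI) (simp add: prod_eq_iff snd_eq)
    have "poly q r = 0"
    proof (rule ccontr)
      assume "poly q r \<noteq> 0"
      moreover have "fst ` E \<subseteq> {x. poly (poly q r) x = 0}"
        using zeros(2) snd_eq by (auto simp: eval2_def poly_poly_inner[of q r])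
      ultimately have "card (fst ` E) \<le> degree (poly q r)"
        using card_poly_roots_bound[of "poly q r"] poly_roots_finite[of "poly q r"] 
          card_mono[of "{x. poly (poly q r) x = 0}" "fst ` E"] by linarith
      also have "\<dots> \<le> k"
        by (rule degree_restrict_to_graph[OF assms(2)]) (simp add: r_def)
      finally show False using inj assms(4) by (simp add: card_image)
    qed
    with False show ?thesis
      by (simp add: m line_dvd_iff_graph r_def)
  next
    case True
    define g where "g = map_poly (\<lambda>p. poly p (- a / b)) q"
    have fst_eq: "fst A = - a / b" if "A \<in> E" for A
      using on_line[OF that] True bc by (simp add: field_simps)
    have inj: "inj_on snd E"
      by (rule inj_onI) (simp add: prod_eq_iff fst_eq)
    have poly_g: "poly g y = eval2 q (- a / b, y)" for y
      unfolding g_def eval2_def by (induction q) (simp_all add: map_poly_pCons)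
    have "g = 0"
    proof (rule ccontr)
      assume g: "g \<noteq> 0"
      moreover have "snd ` E \<subseteq> {y. poly g y = 0}"
      proof clarify
        fix x y assume "(x, y) \<in> E"
        with zeros(2)[OF this] fst_eq[OF this] show "poly g (snd (x, y)) = 0"
          by (simp add: poly_g)
      qed
      ultimately have "card (snd ` E) \<le> degree g"
        using card_poly_roots_bound[of g] poly_roots_finite[of g] 
          card_mono[of "{x. poly g x = 0}" "snd ` E"] by linarith
      also have "degree g \<le> k"
      proof (rule degree_le, intro allI impI)
        fix i assume "k < i"
        then have "coeff q i = 0"
          using assms(2) by (intro poly_eqI) (force simp: Pi_n_def)
        then show "coeff g i = 0" by (simp add: g_def coeff_map_poly)
      qed
      finally show False using inj assms(4) by (simp add: card_image)
    qed
    \<comment> \<open>As y is the outer variable, divisibility by a polynomial in x alone can be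
      tested on each coefficient.\<close>
    have "[:a, b:] dvd coeff q i" for i
    proof -
      have "coeff g i = 0" using \<open>g = 0\<close> by simp
      then have "poly (coeff q i) (- a / b) = 0"
        by (simp add: g_def coeff_map_poly)
      then have "[:a / b, 1:] dvd coeff q i"
        by (simp add: poly_eq_0_iff_dvd)
      then obtain s where s: "coeff q i = [:a / b, 1:] * s" ..
      have "[:a / b, 1:] = [:a, b:] * [:1 / b:]"
        using True bc by simp
      then have "coeff q i = [:a, b:] * ([:1 / b:] * s)"
        unfolding s by (simp only: mult.assoc)
      then show ?thesis by (rule dvdI)
    qed
    then show ?thesis
      using True by (simp add: m const_poly_dvd_iff)
  qed
qed

lemma obtain_separating_line:
  assumes "A \<noteq> B"
  obtains m where "is_line m" "eval2 m A = 0" "eval2 m B \<noteq> 0"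
proof (cases "fst A = fst B")
  case True
  with assms show thesis
    by (intro that[of "[:[:- snd A, 0:], [:1:]:]"] is_lineI) (auto simp: eval2_line prod_eq_iff
        simp del: pCons_eq_0_iff pCons_0_0)
next
  case False
  then show thesis
    by (intro that[of "[:[:- fst A, 1:], [:0:]:]"] is_lineI) (auto simp: eval2_line
        simp del: pCons_eq_0_iff pCons_0_0)
qed

text \<open>Lines are prime, so each one can be cancelled from \<open>r\<close> or from its
  cofactor. Induction collects those cancelled from \<open>r\<close>, and a constant
  remains.\<close>

lemma dvd_prod_lines:
  assumes "finite I" "\<And>i. i \<in> I \<Longrightarrow> is_line (L i)" "r dvd (\<Prod>i\<in>I. L i)"
  shows "\<exists>J c. J \<subseteq> I \<and> c \<in> Pi_n 0 \<and> r = c * (\<Prod>i\<in>J. L i)"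
  using assms
proof (induction I arbitrary: r rule: finite_induct)
  case empty
  then obtain s where s: "1 = r * s" by auto
  then have "r \<noteq> 0" "s \<noteq> 0" by auto
  then have "tdeg r + tdeg s = tdeg 1" using s tdeg_mult[of r s] by simp
  also have "\<dots> = 0" using Pi_n_const[of 1 0] by (simp add: Pi_n_iff one_pCons)
  finally have "r \<in> Pi_n 0" by (simp add: Pi_n_iff)
  then show ?case by (intro exI[of _ "{}"] exI[of _ r]) simp
next
  case (insert k I)
  have L: "is_line (L k)" and L0: "L k \<noteq> 0" using insert.prems is_line_nonzero by auto
  from insert.prems(2) insert.hyps obtain s where s: "L k * (\<Prod>i\<in>I. L i) = r * s"
    by auto
  then have "L k dvd r * s" by (metis dvd_triv_left)
  then consider "L k dvd r" | "L k dvd s"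
    using prime_elem_line[OF L] by (auto dest: prime_elem_dvd_multD)
  then show ?case
  proof cases
    case 1
    then obtain r' where r': "r = L k * r'" by auto
    with s L0 have "(\<Prod>i\<in>I. L i) = r' * s" by (simp add: mult.assoc)
    then have "r' dvd (\<Prod>i\<in>I. L i)" by simp
    with insert.IH[of r'] insert.prems(1) obtain J c
      where J: "J \<subseteq> I" "c \<in> Pi_n 0" "r' = c * (\<Prod>i\<in>J. L i)" by auto
    have "finite J" "k \<notin> J" using J insert.hyps by (auto intro: finite_subset)
    with J r' show ?thesis
      by (intro exI[of _ "insert k J"] exI[of _ c]) (auto simp: ac_simps)
  next
    case 2
    then obtain s' where s': "s = L k * s'" by auto
    with s have "L k * (\<Prod>i\<in>I. L i) = L k * (r * s')" by (simp add: ac_simps)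
    with L0 have "(\<Prod>i\<in>I. L i) = r * s'" by simp
    then have "r dvd (\<Prod>i\<in>I. L i)" by simp
    with insert.IH[of r] insert.prems(1) show ?thesis by blast
  qed
qed

lemma tdeg_prod_lines:
  assumes "finite I" "\<And>i. i \<in> I \<Longrightarrow> is_line (L i)"
  shows "(\<Prod>i\<in>I. L i) \<noteq> 0 \<and> tdeg (\<Prod>i\<in>I. L i) = card I"
  using assms
proof (induction I rule: finite_induct)
  case empty
  then show ?case using Pi_n_const[of 1 0] by (simp add: Pi_n_iff one_pCons)
next
  case (insert k I)
  then show ?case
    using tdeg_mult[of "L k" "prod L I"] is_line_nonzero[of "L k"] 
    by (simp add: is_line_iff_tdeg)
qed

section \<open>Fundamental polynomials\<close>

lemma fundamental_poly:
  assumes "poised n X" "A \<in> X"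
  shows "fundamental_poly n X A \<in> Pi_n n" "eval2 (fundamental_poly n X A) A = 1"
    "B \<in> X \<Longrightarrow> B \<noteq> A \<Longrightarrow> eval2 (fundamental_poly n X A) B = 0"
  using theI'[OF fundamental_poly_ex1[OF assms]] by (auto simp: fundamental_poly_def)

lemma fundamental_poly_eqI:
  assumes "poised n X" "A \<in> X" "p \<in> Pi_n n" "eval2 p A = 1"
    "\<And>B. B \<in> X \<Longrightarrow> B \<noteq> A \<Longrightarrow> eval2 p B = 0"
  shows "fundamental_poly n X A = p"
  unfolding fundamental_poly_def
  by (rule the1_equality[OF fundamental_poly_ex1[OF assms(1,2)]]) (use assms in auto)

text \<open>In the Lagrange expansion of \<open>g\<close> only the fundamental polynomials of
  \<open>V\<close> occur, and \<open>l\<close> divides each of them.\<close>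

lemma dvd_if_vanishing_off_users:
  assumes "poised n X" "g \<in> Pi_n n" "V \<subseteq> X" "\<And>A. A \<in> V \<Longrightarrow> uses_line n X A l"
    and "\<And>A. A \<in> X - V \<Longrightarrow> eval2 g A = 0"
  shows "l dvd g"
proof -
  have fin: "finite X" "finite V"
    using assms(1,3) by (auto simp: poised_def intro: finite_subset)
  define s where "s = (\<Sum>A\<in>V. [:[:eval2 g A:]:] * fundamental_poly n X A)"
  have s_in: "s \<in> Pi_n n"
    unfolding s_def using assms(1,3)
    by (intro Pi_n_sum Pi_n_mult[OF Pi_n_const[of _ 0] fundamental_poly(1)]) auto
  have s_eval: "eval2 s B = eval2 g B" if "B \<in> X" for B
  proof -
    have "eval2 (fundamental_poly n X A) B = (if A = B then 1 else 0)" if "A \<in> V" for A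
      using fundamental_poly(3)[OF assms(1), of A B] fundamental_poly(2)[OF assms(1), of A] that \<open>B \<in> X\<close> assms(3) by auto
    then have "eval2 s B = (\<Sum>A\<in>V. if A = B then eval2 g A else 0)"
      unfolding s_def eval2_sum eval2_simps(4) eval2_const
      by (intro sum.cong) auto
    then show ?thesis using that assms(5) fin by auto
  qed
  have "g - s = 0"
    using s_eval by (intro poised_eq_0[OF assms(1) Pi_n_diff[OF assms(2) s_in]]) simp
  moreover have "l dvd s"
    unfolding s_def
  proof (intro dvd_sum dvd_mult)
    show "l dvd fundamental_poly n X A" if "A \<in> V" for A
      using assms(4)[OF that] by (auto simp: uses_line_def)
  qed
  ultimately show ?thesis by simp
qed

section \<open>Maximal curves\<close>

text \<open>The number of nodes off the curve is only bounded from above by the dimension of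
  \<open>Pi_n k\<close>; that the bound is attained, which makes \<open>C\<close> a maximal curve,
  is derived in \<open>card_W\<close>.\<close>

locale few_nodes_off_curve =
  fixes n k :: nat and X :: "point set" and C :: bipoly
  assumes poised: "poised n X" and k_le: "k \<le> n"
    and C_in: "C \<in> Pi_n (n - k)" and C_nonzero: "C \<noteq> 0"
    and card_le: "card {A \<in> X. eval2 C A \<noteq> 0} \<le> card (exps k)"
begin

abbreviation "W \<equiv> {A \<in> X. eval2 C A \<noteq> 0}"

lemma mult_in: "p \<in> Pi_n k \<Longrightarrow> C * p \<in> Pi_n n"
  using k_le by (intro Pi_n_mult[OF C_in]) auto

lemma finite_W: "finite W"
  using poised by (auto simp: poised_def)

text \<open>If \<open>p\<close> vanishes on \<open>W\<close>, then \<open>C * p\<close> vanishes at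
  every node, so uniqueness is inherited from \<open>X\<close>.\<close>

lemma poised_W: "poised k W"
proof (rule poisedI)
  fix p assume "p \<in> Pi_n k" "\<And>A. A \<in> W \<Longrightarrow> eval2 p A = 0"
  then have "C * p = 0"
    by (intro poised_eq_0[OF poised] mult_in) auto
  with C_nonzero show "p = 0" by simp
qed (use finite_W card_le in auto)

lemma card_W: "card W = card (exps k)"
  using card_poised_ge[OF poised_W] card_le by simp

text \<open>\<open>g\<close> interpolates the quotient of \<open>f\<close> by \<open>C\<close> on
  \<open>W\<close>; then \<open>C * g\<close> and \<open>f\<close> agree at all nodes, as both
  vanish at the nodes outside \<open>W\<close>.\<close>

lemma factor_if_vanishing:
  assumes "f \<in> Pi_n n" "\<And>A. A \<in> X - W \<Longrightarrow> eval2 f A = 0"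
  obtains g where "g \<in> Pi_n k" "f = C * g"
proof -
  from poised_interpolates[OF poised_W, of "\<lambda>A. eval2 f A / eval2 C A"] obtain g
    where g: "g \<in> Pi_n k" "\<And>A. A \<in> W \<Longrightarrow> eval2 g A = eval2 f A / eval2 C A" by blast
  have "eval2 (f - C * g) A = 0" if "A \<in> X" for A
    using g(2)[of A] assms(2)[of A] that by (cases "A \<in> W") auto
  then have "f - C * g = 0"
    by (intro poised_eq_0[OF poised] Pi_n_diff mult_in g assms)
  with g that show thesis by simp
qed

lemma fundamental_poly_factor:
  assumes "A \<in> W"
  shows "fundamental_poly n X A = [:[:1 / eval2 C A:]:] * (C * fundamental_poly k W A)"
proof (rule fundamental_poly_eqI[OF poised])
  note f = fundamental_poly[OF poised_W assms]
  show "[:[:1 / eval2 C A:]:] * (C * fundamental_poly k W A) \<in> Pi_n n"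
    using Pi_n_mult[OF Pi_n_const[of _ 0] mult_in[OF f(1)]] by simp
  show "eval2 ([:[:1 / eval2 C A:]:] * (C * fundamental_poly k W A)) A = 1"
    unfolding eval2_simps(4) eval2_const using f(2) assms by simp
  show "eval2 ([:[:1 / eval2 C A:]:] * (C * fundamental_poly k W A)) B = 0"
    if "B \<in> X" "B \<noteq> A" for B
    unfolding eval2_simps(4) eval2_const using f(3)[of B] that by auto
qed (use assms in auto)

end

section \<open>The complementary curve\<close>

lemma sum_mult_const_in: "(\<And>i. i \<in> I \<Longrightarrow> f i \<in> Pi_n k) \<Longrightarrow> (\<Sum>i\<in>I. [:[:c i:]:] * f i) \<in> Pi_n k"
  by (intro Pi_n_sum Pi_n_mult[OF Pi_n_const[of _ 0]]) auto

text \<open>If \<open>M\<close> divided \<open>Q\<close>, then \<open>f\<close> would be a multiple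
  of \<open>h\<close>, by degree reasons with a factor of degree at most 1, which is excluded. So
  \<open>M\<close> is not constant, hence a line and prime; it divides \<open>Q * h\<close>, hence
  \<open>h\<close>, and cancelling it produces \<open>C\<close>.\<close>

lemma obtain_curve_from_relation:
  assumes "h \<in> Pi_n k" "h \<noteq> 0" "f \<in> Pi_n (Suc k)"
    and f_ndvd: "\<And>r. r \<in> Pi_n 1 \<Longrightarrow> f \<noteq> r * h"
    and h_deg: "\<And>i. h \<in> Pi_n i \<Longrightarrow> k \<le> i"
    and QM: "Q \<in> Pi_n 2" "M \<in> Pi_n 1" "Q \<noteq> 0 \<or> M \<noteq> 0" "Q * h + M * f = 0"
  obtains C where "is_line M" "h = M * C" "f = - Q * C" "\<not> M dvd Q" "k \<ge> 1" "C \<in> Pi_n (k - 1)"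
proof -
  have "M \<noteq> 0" using QM assms(2) by auto
  have ndvd: "\<not> M dvd Q"
  proof
    assume "M dvd Q"
    then obtain r where r: "Q = M * r" ..
    have "M * (r * h + f) = Q * h + M * f" by (simp add: r algebra_simps)
    with QM \<open>M \<noteq> 0\<close> have "r * h + f = 0" by simp
    then have f: "f = (- r) * h" by (simp add: eq_neg_iff_add_eq_0 add.commute)
    with f_ndvd[of "- r"] have "- r \<notin> Pi_n 1" by blast
    then have "tdeg (- r) \<ge> 2" "- r \<noteq> 0" using Pi_n_0[of 1] by (auto simp: Pi_n_iff simp del: Pi_n_0)
    moreover from this have "tdeg (- r) + tdeg h \<le> Suc k"
      using assms(2,3) tdeg_mult[of "- r" h] by (simp add: Pi_n_iff f)
    moreover have "k \<le> tdeg h"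
      by (rule h_deg) (simp add: Pi_n_iff)
    ultimately show False by linarith
  qed
  have line: "is_line M"
    unfolding is_line_def
  proof (intro conjI notI QM)
    assume "M \<in> Pi_n 0"
    then obtain c where "M = [:[:c:]:]" by (rule Pi_0_const)
    with \<open>M \<noteq> 0\<close> have "M dvd 1" by (simp add: is_unit_const_poly_iff dvd_field_iff)
    then have "M dvd Q" by (rule unit_imp_dvd)
    with ndvd show False by simp
  qed
  have "Q * h = M * (- f)" using QM(4) by (simp add: eq_neg_iff_add_eq_0)
  then have "M dvd Q * h" by (metis dvd_triv_left)
  with prime_elem_line[OF line] ndvd have "M dvd h" by (auto dest: prime_elem_dvd_multD)
  then obtain C where C: "h = M * C" ..
  with assms(2) have "C \<noteq> 0" by auto
  have "M * (Q * C + f) = Q * h + M * f" by (simp add: C algebra_simps)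
  with QM \<open>M \<noteq> 0\<close> have "Q * C + f = 0" by simp
  then have "f = - Q * C" by (simp add: eq_neg_iff_add_eq_0 add.commute)
  moreover have "1 + tdeg C \<le> k"
    using assms(1) tdeg_mult[OF \<open>M \<noteq> 0\<close> \<open>C \<noteq> 0\<close>] line by (simp add: Pi_n_iff C is_line_iff_tdeg)
  then have "k \<ge> 1" "C \<in> Pi_n (k - 1)" by (auto simp: Pi_n_iff)
  ultimately show thesis using that line C ndvd by blast
qed

section \<open>Four users of a line through four nodes\<close>

locale line_with_four_users =
  fixes n :: nat and X :: "point set" and l :: bipoly and V :: "point set"
  assumes n_pos: "n \<ge> 1" and poised: "poised n X" and line: "is_line l"
    and card_T: "card {A \<in> X. eval2 l A = 0} = 4"
    and V_sub: "V \<subseteq> X" and card_V: "card V = 4"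
    and users: "\<And>A. A \<in> V \<Longrightarrow> uses_line n X A l"
begin

abbreviation "T \<equiv> {A \<in> X. eval2 l A = 0}"
abbreviation "Z \<equiv> X - T - V"

lemma finite_X: "finite X" and finite_T: "finite T" and finite_V: "finite V"
  using poised V_sub by (auto simp: poised_def intro: finite_subset)

definition q :: "point \<Rightarrow> bipoly" where
  "q A = (SOME q. q \<in> Pi_n (n - 1) \<and> fundamental_poly n X A = l * q)"

lemma q:
  assumes "A \<in> V"
  shows "q A \<in> Pi_n (n - 1)" "fundamental_poly n X A = l * q A"
proof -
  have "\<exists>q. q \<in> Pi_n (n - 1) \<and> fundamental_poly n X A = l * q"
    using users[OF assms] by (auto simp: uses_line_def)
  then have "q A \<in> Pi_n (n - 1) \<and> fundamental_poly n X A = l * q A"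
    unfolding q_def by (rule someI_ex)
  then show "q A \<in> Pi_n (n - 1)" "fundamental_poly n X A = l * q A" by auto
qed

lemma V_off_line: "A \<in> V \<Longrightarrow> eval2 l A \<noteq> 0"
  using fundamental_poly(2)[OF poised, of A] q(2)[of A] V_sub by auto

lemma q_self: "A \<in> V \<Longrightarrow> eval2 (q A) A \<noteq> 0"
  using fundamental_poly(2)[OF poised, of A] q(2)[of A] V_sub by auto

text \<open>Nodes of the line are left out: there \<open>l\<close> already supplies the zero, and
  the value of \<open>q A\<close> is not controlled.\<close>

lemma q_other: "A \<in> V \<Longrightarrow> B \<in> X \<Longrightarrow> B \<noteq> A \<Longrightarrow> eval2 l B \<noteq> 0 \<Longrightarrow> eval2 (q A) B = 0"
  using fundamental_poly(3)[OF poised, of A B] q(2)[of A] V_sub by auto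

text \<open>Up to scaling, the \<open>q A\<close> are dual to the points of \<open>V\<close>; in
  particular they are linearly independent.\<close>

lemma eval2_q_combination:
  assumes "B \<in> V"
  shows "eval2 (\<Sum>A\<in>V. [:[:c A:]:] * q A) B = c B * eval2 (q B) B"
proof -
  have "eval2 (\<Sum>A\<in>V. [:[:c A:]:] * q A) B = (\<Sum>A\<in>V. if A = B then c B * eval2 (q B) B else 0)"
    unfolding eval2_sum eval2_simps(4) eval2_const
  proof (intro sum.cong)
    fix A assume "A \<in> V"
    then show "c A * eval2 (q A) B = (if A = B then c B * eval2 (q B) B else 0)"
      using q_other[of A B] assms V_off_line[OF assms] V_sub by auto
  qed simp
  then show ?thesis using assms finite_V by simp
qed

lemma q_combination_nonzero: "A \<in> V \<Longrightarrow> c A \<noteq> 0 \<Longrightarrow> (\<Sum>A\<in>V. [:[:c A:]:] * q A) \<noteq> 0"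
  using eval2_q_combination[of A c] q_self[of A] by auto

lemma q_on_Z: "A \<in> V \<Longrightarrow> B \<in> Z \<Longrightarrow> eval2 (q A) B = 0"
  using q_other[of A B] by auto

lemma q_combination_on_Z: "B \<in> Z \<Longrightarrow> eval2 (\<Sum>A\<in>V. [:[:c A:]:] * q A) B = 0"
  unfolding eval2_sum eval2_simps(4) eval2_const
  by (rule sum.neutral) (simp add: q_on_Z)

text \<open>A combination of the four \<open>q A\<close> can be made to vanish at all nodes of the line but one;
  after multiplication by a line through the last node it lies in the span of the
  fundamental polynomials of \<open>V\<close>, hence is divisible by \<open>l\<close>.\<close>

lemma obtain_h:
  obtains h k where "n = Suc (Suc k)" "h \<in> Pi_n k" "h \<noteq> 0" "\<And>A. A \<in> Z \<Longrightarrow> eval2 h A = 0"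
proof -
  have "T \<noteq> {}" using card_T by (metis card.empty zero_neq_numeral)
  then obtain T1 where T1: "T1 \<in> T" by blast
  have card_T': "card (T - {T1}) = 3" using card_T T1 finite_T by simp
  then have "T - {T1} \<noteq> {}" by (metis card.empty zero_neq_numeral)
  then obtain T2 where T2: "T2 \<in> T - {T1}" by blast
  \<comment> \<open>\<open>T2\<close> keeps \<open>m\<close> from being a multiple of
    \<open>l\<close>, since \<open>l\<close> vanishes at \<open>T2\<close>.\<close>
  obtain m where m: "is_line m" "eval2 m T1 = 0" "eval2 m T2 \<noteq> 0"
    using T2 obtain_separating_line[of T1 T2] by auto
  have "\<exists>c. (\<exists>A\<in>V. c A \<noteq> 0) \<and> (\<forall>B\<in>T - {T1}. (\<Sum>A\<in>V. c A * eval2 (q A) B) = 0)"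
    using finite_T finite_V card_T' card_V
    by (intro homogeneous_system_nontrivial) auto
  then obtain c where c: "\<exists>A\<in>V. c A \<noteq> 0" "\<forall>B\<in>T - {T1}. (\<Sum>A\<in>V. c A * eval2 (q A) B) = 0"
    by blast
  define f where "f = (\<Sum>A\<in>V. [:[:c A:]:] * q A)"
  have f_in: "f \<in> Pi_n (n - 1)" unfolding f_def by (intro sum_mult_const_in q)
  have f_nz: "f \<noteq> 0" using c(1) q_combination_nonzero unfolding f_def by blast
  have f_T: "eval2 f B = 0" if "B \<in> T - {T1}" for B
    unfolding f_def eval2_sum eval2_simps(4) eval2_const using c(2) that by blast
  have f_Z: "eval2 f B = 0" if "B \<in> Z" for B
    unfolding f_def by (rule q_combination_on_Z[OF that])
  have "l dvd m * f"
  proof (rule dvd_if_vanishing_off_users[OF poised _ V_sub users])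
    show "m * f \<in> Pi_n n"
      using m(1) f_in n_pos by (intro Pi_n_mult[of m 1 f "n - 1"]) (auto simp: is_line_def)
    show "eval2 (m * f) A = 0" if "A \<in> X - V" for A
    proof (cases "A = T1")
      case True
      then show ?thesis using m by simp
    next
      case False
      then have "eval2 f A = 0"
        using that f_T[of A] f_Z[of A] by (cases "A \<in> T") auto
      then show ?thesis by simp
    qed
  qed
  moreover have "\<not> l dvd m"
    using T2 m(3) by auto
  ultimately have "l dvd f"
    using prime_elem_line[OF line] by (auto dest: prime_elem_dvd_multD)
  then obtain h where h: "f = l * h" ..
  then have h_nz: "h \<noteq> 0" using f_nz by auto
  \<comment> \<open>This also gives n \<ge> 2, so that the subtraction in \<open>n - 2\<close> is
    not truncated.\<close>
  have deg: "1 + tdeg h \<le> n - 1"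
    using f_in tdeg_mult[OF is_line_nonzero[OF line] h_nz] line
    by (simp add: Pi_n_iff h is_line_iff_tdeg)
  show thesis
  proof (rule that[of "n - 2" h])
    show "n = Suc (Suc (n - 2))" using deg by simp
    show "h \<in> Pi_n (n - 2)" using deg by (simp add: Pi_n_iff)
    show "eval2 h A = 0" if "A \<in> Z" for A
      using f_Z[OF that] that by (auto simp: h)
  qed (rule h_nz)
qed

lemma eq_0_if_vanishing_off_line:
  assumes "p \<in> Pi_n (n - 1)" "\<And>A. A \<in> Z \<Longrightarrow> eval2 p A = 0" "\<And>A. A \<in> V \<Longrightarrow> eval2 p A = 0"
  shows "p = 0"
proof -
  have "l * p = 0"
  proof (rule poised_eq_0[OF poised])
    show "l * p \<in> Pi_n n"
      using line assms(1) n_pos by (intro Pi_n_mult[of l 1 p "n - 1"]) (auto simp: is_line_def)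
    show "eval2 (l * p) A = 0" if "A \<in> X" for A
      using that assms(2,3)[of A] by auto
  qed
  with is_line_nonzero[OF line] show ?thesis by simp
qed

text \<open>Otherwise the four multipliers would be linearly dependent in the 3-dimensional space
  \<open>Pi_n 1\<close>, and so would the \<open>q A\<close>.\<close>

lemma exists_q_not_multiple:
  assumes "h \<noteq> 0"
  obtains A where "A \<in> V" "\<And>r. r \<in> Pi_n 1 \<Longrightarrow> q A \<noteq> r * h"
proof (rule ccontr)
  assume "\<not> thesis"
  with that have "\<forall>A\<in>V. \<exists>r. r \<in> Pi_n 1 \<and> q A = r * h" by metis
  then obtain r where r: "\<And>A. A \<in> V \<Longrightarrow> r A \<in> Pi_n 1" "\<And>A. A \<in> V \<Longrightarrow> q A = r A * h"
    by metis
  have "\<exists>c. (\<exists>A\<in>V. c A \<noteq> 0) \<and>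
      (\<forall>e\<in>exps 1. (\<Sum>A\<in>V. c A * coeff (coeff (r A) (fst e)) (snd e)) = 0)"
    using finite_V card_V card_exps_numeral(1) by (intro homogeneous_system_nontrivial) auto
  then obtain c where c: "\<exists>A\<in>V. c A \<noteq> 0"
    "\<forall>e\<in>exps 1. (\<Sum>A\<in>V. c A * coeff (coeff (r A) (fst e)) (snd e)) = 0" by blast
  define s where "s = (\<Sum>A\<in>V. [:[:c A:]:] * r A)"
  have s_in: "s \<in> Pi_n 1" unfolding s_def by (intro sum_mult_const_in r)
  have "s = 0"
  proof (intro poly_eqI)
    fix i j
    show "coeff (coeff s i) j = coeff (coeff 0 i) j"
    proof (cases "(i, j) \<in> exps 1")
      case True
      with c(2) show ?thesis by (force simp: s_def coeff_sum)
    next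
      case False
      then show ?thesis using Pi_n_coeff[OF s_in] by (simp add: in_exps_iff)
    qed
  qed
  have "(\<Sum>A\<in>V. [:[:c A:]:] * q A) = s * h"
    by (simp add: s_def r(2) sum_distrib_right mult.assoc)
  with \<open>s = 0\<close> have "(\<Sum>A\<in>V. [:[:c A:]:] * q A) = 0" by simp
  with c(1) q_combination_nonzero[of _ c] show False by blast
qed

lemma obtain_cubic_complement_curve:
  obtains C where "n \<ge> 3" "C \<in> Pi_n (n - 3)" "C \<noteq> 0"
    "card {A \<in> X. eval2 (l * C) A \<noteq> 0} \<le> 6"
proof -
  obtain h k where n: "n = Suc (Suc k)" and h: "h \<in> Pi_n k" "h \<noteq> 0"
    "\<And>A. A \<in> Z \<Longrightarrow> eval2 h A = 0" using obtain_h by blast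
  \<comment> \<open>\<open>h\<close> has degree exactly \<open>k\<close>: otherwise its product with
    a nonzero quadratic vanishing on \<open>V\<close> would have degree at most \<open>n - 1\<close>
    and vanish at all nodes off the line.\<close>
  have h_deg: "k \<le> i" if "h \<in> Pi_n i" for i
  proof (rule ccontr)
    assume "\<not> k \<le> i"
    have "card V < card (exps 2)" using card_V by simp
    then obtain p where p: "p \<in> Pi_n 2" "p \<noteq> 0" "\<And>A. A \<in> V \<Longrightarrow> eval2 p A = 0"
      using exists_vanishing_poly[OF finite_V] by blast
    have "p * h = 0"
    proof (rule eq_0_if_vanishing_off_line)
      show "p * h \<in> Pi_n (n - 1)"
        using \<open>\<not> k \<le> i\<close> by (intro Pi_n_mult[OF p(1) that]) (simp add: n)
    qed (use p h in auto)
    with p h show False by simp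
  qed
  obtain A0 where A0: "A0 \<in> V" and f_ndvd: "\<And>r. r \<in> Pi_n 1 \<Longrightarrow> q A0 \<noteq> r * h"
    using exists_q_not_multiple[OF h(2)] by blast
  let ?f = "q A0"
  have f_in: "?f \<in> Pi_n (Suc k)" using q(1)[OF A0] n by simp
  have f_Z: "eval2 ?f A = 0" if "A \<in> Z" for A by (rule q_on_Z[OF A0 that])
  have "finite (T \<union> V)" using finite_T finite_V by simp
  \<comment> \<open>At most 8 conditions against 6 + 3 coefficients; at the nodes of
    \<open>Z\<close> both \<open>h\<close> and \<open>?f\<close> vanish anyway.\<close>
  moreover have "card (T \<union> V) < card (exps 2) + card (exps 1)"
    using card_Un_le[of T V] card_T card_V card_exps_numeral by linarith
  ultimately obtain Q M where QM: "Q \<in> Pi_n 2" "M \<in> Pi_n 1" "Q \<noteq> 0 \<or> M \<noteq> 0"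
    and QM_zero: "\<And>A. A \<in> T \<union> V \<Longrightarrow> eval2 (Q * h + M * ?f) A = 0"
    by (rule exists_combination_vanishing[where f = h and g = ?f]) blast
  have rel: "Q * h + M * ?f = 0"
  proof (rule poised_eq_0[OF poised])
    show "Q * h + M * ?f \<in> Pi_n n"
      using n by (intro Pi_n_add Pi_n_mult[OF QM(1) h(1)] Pi_n_mult[OF QM(2) f_in]) auto
    show "eval2 (Q * h + M * ?f) A = 0" if "A \<in> X" for A
      using QM_zero[of A] h(3)[of A] f_Z[of A] that by (cases "A \<in> T \<union> V") auto
  qed
  from obtain_curve_from_relation[OF h(1,2) f_in f_ndvd h_deg QM rel] obtain C
    where C: "is_line M" "h = M * C" "?f = - Q * C" "\<not> M dvd Q" "k \<ge> 1" "C \<in> Pi_n (k - 1)"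
    by blast
  define B where "B = {A \<in> Z. eval2 C A \<noteq> 0}"
  have finite_B: "finite B" using finite_X by (simp add: B_def)
  \<comment> \<open>Since \<open>M * C\<close> and \<open>Q * C\<close> vanish on \<open>Z\<close>,
    both \<open>M\<close> and \<open>Q\<close> vanish on \<open>B\<close>; three such points would
    make the line \<open>M\<close> divide the quadratic \<open>Q\<close>.\<close>
  have card_B: "card B \<le> 2"
  proof (rule ccontr)
    assume "\<not> card B \<le> 2"
    then have "M dvd Q"
    proof (intro line_dvd_if_many_zeros[OF C(1) QM(1) finite_B])
      show "eval2 M A = 0" if "A \<in> B" for A
        using h(3)[of A] that by (auto simp: B_def C(2))
      show "eval2 Q A = 0" if "A \<in> B" for A
      proof -
        have "eval2 (Q * C + ?f) A = 0" unfolding C(3) by simp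
        with f_Z[of A] that show ?thesis by (auto simp: B_def)
      qed
    qed simp
    with C(4) show False by simp
  qed
  have "{A \<in> X. eval2 (l * C) A \<noteq> 0} \<subseteq> V \<union> B"
    by (auto simp: B_def)
  then have "card {A \<in> X. eval2 (l * C) A \<noteq> 0} \<le> card (V \<union> B)"
    using finite_V finite_B by (intro card_mono) auto
  also have "\<dots> \<le> 6" using card_Un_le[of V B] card_V card_B by linarith
  finally show thesis
    using C h(2) n by (intro that[of C]) auto
qed

end

theorem corollary4p1:
  fixes n :: nat and X :: "point set" and l :: bipoly
  assumes "n \<ge> 1"
    and "poised n X"
    and "is_line l"
    and "card {A \<in> X. eval2 l A = 0} = 4"
    and "card {A \<in> X. uses_line n X A l} \<ge> 4"
  shows "card {A \<in> X. uses_line n X A l} = 6 \<and>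
         poised 2 {A \<in> X. uses_line n X A l} \<and>
         (GC_set n X \<longrightarrow> GC_set 2 {A \<in> X. uses_line n X A l})"
proof -
  let ?U = "{A \<in> X. uses_line n X A l}"
  obtain V where V: "V \<subseteq> ?U" "card V = 4"
    using obtain_subset_with_card_n[OF assms(5)] by blast
  interpret line_with_four_users n X l V
    by unfold_locales (use assms V in auto)
  obtain C where n3: "n \<ge> 3" and C: "C \<in> Pi_n (n - 3)" "C \<noteq> 0"
    and card_D: "card {A \<in> X. eval2 (l * C) A \<noteq> 0} \<le> 6"
    by (rule obtain_cubic_complement_curve)
  let ?D = "{A \<in> X. eval2 (l * C) A \<noteq> 0}"
  have l_nz: "l \<noteq> 0" and l_in: "l \<in> Pi_n 1"
    using assms(3) is_line_nonzero by (auto simp: is_line_def)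
  interpret conics: few_nodes_off_curve n 2 X "l * C"
  proof
    show "l * C \<in> Pi_n (n - 2)"
      using n3 by (intro Pi_n_mult[OF l_in C(1)]) auto
  qed (use assms n3 C l_nz card_D in auto)
  interpret cubics: few_nodes_off_curve n 3 X C
  proof
    have "{A \<in> X. eval2 C A \<noteq> 0} \<subseteq> ?D \<union> T" by auto
    then have "card {A \<in> X. eval2 C A \<noteq> 0} \<le> card (?D \<union> T)"
      using finite_X by (intro card_mono) auto
    also have "\<dots> \<le> 10" using card_Un_le[of ?D T] card_D card_T by linarith
    finally show "card {A \<in> X. eval2 C A \<noteq> 0} \<le> card (exps 3)" by simp
  qed (use assms n3 C in auto)
  have D_uses: "uses_line n X A l" if "A \<in> ?D" for A
    unfolding uses_line_def
  proof
    let ?s = "C * ([:[:1 / eval2 (l * C) A:]:] * fundamental_poly 2 ?D A)"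
    show "fundamental_poly n X A = l * ?s"
      unfolding conics.fundamental_poly_factor[OF that] by (simp only: mult_ac)
    have "[:[:1 / eval2 (l * C) A:]:] * fundamental_poly 2 ?D A \<in> Pi_n 2"
      using fundamental_poly(1)[OF conics.poised_W that]
      by (intro Pi_n_mult[OF Pi_n_const[of _ 0]]) auto
    then show "?s \<in> Pi_n (n - 1)"
      using n3 by (intro Pi_n_mult[OF C(1)]) auto
  qed
  \<comment> \<open>Maximality leaves exactly 10 nodes off \<open>C\<close>, so the bound 6 + 4 is
    attained; in particular \<open>C\<close> passes through no node of the line.\<close>
  have W_eq: "cubics.W = ?D \<union> T"
  proof (rule card_subset_eq)
    show "finite (?D \<union> T)" using finite_X by simp
    show sub: "cubics.W \<subseteq> ?D \<union> T" by auto
    have "card cubics.W \<le> card (?D \<union> T)"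
      using finite_X by (intro card_mono sub) simp
    then show "card cubics.W = card (?D \<union> T)"
      using card_Un_le[of ?D T] card_D card_T cubics.card_W card_exps_numeral(3) by linarith
  qed
  \<comment> \<open>A user outside \<open>?D\<close> would lie on \<open>C\<close>. The aim is that
    \<open>C\<close> divides its cofactor \<open>s\<close>, although \<open>s\<close> does not
    vanish at that node.\<close>
  have user_in_D: "A \<in> ?D" if "A \<in> X" "uses_line n X A l" for A
  proof (rule ccontr)
    assume not_D: "A \<notin> ?D"
    from that(2) obtain s where s: "s \<in> Pi_n (n - 1)" "fundamental_poly n X A = l * s"
      by (auto simp: uses_line_def)
    note f = fundamental_poly[OF poised that(1), unfolded s(2)]
    have lA: "eval2 l A \<noteq> 0" and sA: "eval2 s A \<noteq> 0" using f(2) by auto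
    with not_D that have CA: "eval2 C A = 0" by auto
    have s_zero: "eval2 s B = 0" if "B \<in> X" "B \<noteq> A" "eval2 l B \<noteq> 0" for B
      using f(3)[OF that(1,2)] that(3) by simp
    \<comment> \<open>Apart from \<open>A\<close>, \<open>s\<close> vanishes at all nodes off
      \<open>l\<close>, in particular at those on \<open>C\<close>; the factor \<open>m\<close>
      takes care of \<open>A\<close>, and maximality makes \<open>C\<close> divide the
      product.\<close>
    have factor: "\<exists>g. m * s = C * g" if "is_line m" "eval2 m A = 0" for m
    proof -
      have "m * s \<in> Pi_n n"
        using that s(1) n3 by (intro Pi_n_mult[of m 1 s "n - 1"]) (auto simp: is_line_def)
      moreover have "eval2 (m * s) B = 0" if "B \<in> X - cubics.W" for B
        using s_zero[of B] that \<open>eval2 m A = 0\<close> unfolding W_eq by (cases "B = A") auto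
      ultimately show ?thesis using cubics.factor_if_vanishing[of "m * s"] by blast
    qed
    \<comment> \<open>Two lines through \<open>A\<close>: \<open>m1\<close> is vertical, and
      \<open>m2\<close> avoids the point one unit above \<open>A\<close>, so \<open>m1\<close> does
      not divide \<open>m2\<close>.\<close>
    define m1 where "m1 = [:[:- fst A, 1:], [:0:]:]"
    obtain m2 where m2: "is_line m2" "eval2 m2 A = 0" "eval2 m2 (fst A, snd A + 1) \<noteq> 0"
      using obtain_separating_line[of A "(fst A, snd A + 1)"] by (auto simp: prod_eq_iff)
    have m1: "is_line m1" "eval2 m1 A = 0" "eval2 m1 (fst A, snd A + 1) = 0"
      unfolding m1_def eval2_line by (rule is_lineI) simp_all
    obtain g1 g2 where g: "m1 * s = C * g1" "m2 * s = C * g2"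
      using factor[OF m1(1,2)] factor[OF m2(1,2)] by blast
    \<comment> \<open>Writing \<open>m1 * m2 * s\<close> in two ways as a multiple of
      \<open>C\<close> shows that \<open>m1\<close> divides \<open>g1\<close>; cancelling
      \<open>m1\<close> then leaves \<open>C\<close> as a divisor of \<open>s\<close>.\<close>
    have "C * (m2 * g1) = m2 * (m1 * s)" unfolding g(1) by (simp only: mult_ac)
    also have "\<dots> = m1 * (m2 * s)" by (simp only: mult_ac)
    also have "\<dots> = C * (m1 * g2)" unfolding g(2) by (simp only: mult_ac)
    finally have "m2 * g1 = m1 * g2" using C(2) by simp
    then have "m1 dvd m2 * g1" by simp
    moreover have "\<not> m1 dvd m2"
      using m1(3) m2(3) by auto
    ultimately have "m1 dvd g1"
      using prime_elem_line[OF m1(1)] by (auto dest: prime_elem_dvd_multD)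
    then obtain g' where g': "g1 = m1 * g'" ..
    have "m1 * s = m1 * (C * g')" unfolding g(1) g' by (simp only: mult_ac)
    then have "s = C * g'" using is_line_nonzero[OF m1(1)] by simp
    with CA sA show False by simp
  qed
  have U_eq: "?U = ?D" using D_uses user_in_D by auto
  have "GC_set 2 ?D" if "GC_set n X"
    unfolding GC_set_def
  proof (intro conjI ballI conics.poised_W)
    fix A assume A: "A \<in> ?D"
    let ?r = "fundamental_poly 2 ?D A"
    from that A obtain L where L: "\<forall>i<n. is_line (L i)" "fundamental_poly n X A = (\<Prod>i<n. L i)"
      by (auto simp: GC_set_def)
    let ?P = "\<Prod>i<n. L i" and ?k = "[:[:1 / eval2 (l * C) A:]:]"
    have P: "?P = ?k * (l * C * ?r)"
      using L(2) conics.fundamental_poly_factor[OF A] by simp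
    have "?r dvd ?P" unfolding P by (intro dvd_mult dvd_refl)
    then have "\<exists>J c. J \<subseteq> {..<n} \<and> c \<in> Pi_n 0 \<and> ?r = c * (\<Prod>i\<in>J. L i)"
      using L(1) by (intro dvd_prod_lines) auto
    then obtain J c where J: "J \<subseteq> {..<n}" "c \<in> Pi_n 0" and r: "?r = c * (\<Prod>i\<in>J. L i)"
      by blast
    have finite_J: "finite J" using J(1) finite_subset by blast
    note deg_P = tdeg_prod_lines[of "{..<n}" L, simplified, OF L(1)[rule_format]]
    have deg_J: "tdeg (\<Prod>i\<in>J. L i) = card J"
      using tdeg_prod_lines[OF finite_J, of L] L(1) J(1) by auto
    have nz: "?k \<noteq> 0" "l * C \<noteq> 0" "?r \<noteq> 0"
      using P deg_P by auto
    have deg_c: "tdeg c = 0" using J(2) by (simp add: Pi_n_iff)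
    have deg_r: "tdeg ?r = card J"
      using r nz tdeg_mult[of c "\<Prod>i\<in>J. L i"] deg_J deg_c by auto
    have "tdeg ?k = 0" using Pi_n_const[of _ 0] by (simp add: Pi_n_iff)
    moreover have "l * C * ?r \<noteq> 0" using nz by simp
    \<comment> \<open>The two degrees are at most \<open>n - 2\<close> and 2, so this equality
      forces \<open>?r\<close> to have degree exactly 2 and to contain exactly two of the
      lines.\<close>
    ultimately have "n = tdeg (l * C) + tdeg ?r"
      using deg_P tdeg_mult[OF nz(1), of "l * C * ?r"] tdeg_mult[OF nz(2,3)]
      by (simp only: P) simp
    moreover have "tdeg (l * C) \<le> n - 2" using conics.C_in by (simp add: Pi_n_iff)
    moreover have "tdeg ?r \<le> 2"
      using fundamental_poly(1)[OF conics.poised_W A] by (simp add: Pi_n_iff)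
    ultimately have "card J = 2" using n3 deg_r by linarith
    then obtain i j where ij: "J = {i, j}" "i \<noteq> j" by (auto simp: card_2_iff)
    have lines: "is_line (L i)" "is_line (L j)" using L(1) J(1) ij by auto
    \<comment> \<open>The constant is absorbed into one of the two lines.\<close>
    have "c \<noteq> 0" using r nz by auto
    then have "is_line (c * L i)"
      using lines tdeg_mult[of c "L i"] is_line_nonzero deg_c by (simp add: is_line_iff_tdeg)
    then show "\<exists>L :: nat \<Rightarrow> bipoly. (\<forall>i<2. is_line (L i)) \<and> ?r = (\<Prod>i<2. L i)"
      using lines r ij
      by (intro exI[of _ "\<lambda>k::nat. if k = 0 then c * L i else L j"])
        (simp add: numeral_2_eq_2 mult.assoc)
  qed
  then show ?thesis
    unfolding U_eq using conics.poised_W conics.card_W by simp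
qed

end
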